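(* Let $n\ge 2$, let $S=(s_1,\ldots,s_n)\in\mathcal{G}_n$ with right anti-diagonal $(e_1,\ldots,e_{n-1})$, and let $k\in\mathbb{Z}$. Then $$k\in K_S \iff F_S(|k-s_n|)=1.$$ Equivalently, setting $r_0:=|k-s_n|$ and $r_i:=|r_{i-1}-e_i|$ for $1\le i\le n-1$, $$k\in K_S\iff r_{n-1}=1.$$
   Context: For a finite integer sequence $S=(s_1,\ldots,s_n)$, its difference triangle is defined by $s_a^0:=s_a$ and $s_a^b:=|s_{a+1}^{b-1}-s_a^{b-1}|$ for $b\ge 1$, $1\le a\le n-b$ (superscripts are row indices, not powers). $S$ is Gilbreath if $s_1^b=1$ for every $1\le b\le n-1$. For $n\ge 2$, $\mathcal{G}_n$ is the set of strictly increasing Gilbreath integer sequences $(s_1,\ldots,s_n)$ of length $n$ with $(s_1,s_2)=(2,3)$. The valid-extension set of $S$ is $K_S:=\{k\in\mathbb{Z}:(s_1,\ldots,s_n,k)\text{ is Gilbreath}\}$. The right anti-diagonal of $S$ is $(e_1,\ldots,e_{n-1})$ with $e_i:=s_{n-i}^i$. The folding map $F_S:\mathbb{Z}_{\ge0}\to\mathbb{Z}_{\ge 0}$ is $F_S(d):=\left|\cdots\left||d-e_1|-e_2\right|\cdots-e_{n-1}\right|$, i.e. the maps $x\mapsto|x-e_1|$, $x\mapsto |x-e_2|$, ..., $x\mapsto|x-e_{n-1}|$ are applied successively in this order. *)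

theory Defs
  imports Main
begin

text \<open>
  A finite integer sequence \<open>(s\<^sub>1, \<dots>, s\<^sub>n)\<close> is a list of length \<open>n\<close>, so \<open>s\<^sub>a\<close> is
  \<open>S ! (a - 1)\<close>. Below, \<open>diff_triangle S b a\<close> is the entry in row \<open>b\<close> at (1-based)
  position \<open>a\<close>; it is meaningful only for \<open>a \<ge> 1\<close> and \<open>a + b \<le> n\<close>.
\<close>

primrec diff_triangle :: "int list \<Rightarrow> nat \<Rightarrow> nat \<Rightarrow> int" where
  "diff_triangle S 0 a = S ! (a - 1)"
| "diff_triangle S (Suc b) a = \<bar>diff_triangle S b (a + 1) - diff_triangle S b a\<bar>"

definition gilbreath :: "int list \<Rightarrow> bool" where
  "gilbreath S \<longleftrightarrow> (\<forall>b\<in>{1..length S - 1}. diff_triangle S b 1 = 1)"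

definition gilbreath_seqs :: "nat \<Rightarrow> int list set" where
  "gilbreath_seqs n =
    {S. length S = n \<and> sorted_wrt (<) S \<and> gilbreath S \<and> S ! 0 = 2 \<and> S ! 1 = 3}"

definition valid_extensions :: "int list \<Rightarrow> int set" where
  "valid_extensions S = {k. gilbreath (S @ [k])}"

text \<open>The list \<open>[e\<^sub>1, \<dots>, e\<^sub>n\<^sub>-\<^sub>1]\<close>; hence \<open>e\<^sub>i\<close> is its entry \<open>! (i - 1)\<close>.\<close>

definition right_antidiagonal :: "int list \<Rightarrow> int list" where
  "right_antidiagonal S = map (\<lambda>i. diff_triangle S i (length S - i)) [1..<length S]"

definition folding_map :: "int list \<Rightarrow> nat \<Rightarrow> nat" where
  "folding_map S d = fold (\<lambda>e x. nat \<bar>int x - e\<bar>) (right_antidiagonal S) d"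

end

theory Submission
  imports Defs
begin

text \<open>
  Appending \<open>k\<close> to \<open>S\<close> adds exactly one right anti-diagonal to the difference triangle. Its entry in
  row \<open>i + 1\<close> is \<open>\<bar>r\<^sub>i\<^sub>-\<^sub>1 - e\<^sub>i\<bar>\<close>, so it is \<open>r\<^sub>i\<close>, and the only new Gilbreath condition is that its
  last entry \<open>r\<^sub>n\<^sub>-\<^sub>1\<close> is \<open>1\<close>.
\<close>

text \<open>The entry in row \<open>b\<close> at position \<open>a\<close> depends only on the terms
  at positions \<open>a\<close> to \<open>a + b\<close>.\<close>

lemma diff_triangle_append:
  assumes "a \<ge> 1" and "a + b \<le> length S"
  shows "diff_triangle (S @ T) b a = diff_triangle S b a"
  using assms by (induction b arbitrary: a) (auto simp: nth_append)

lemma gilbreath_snoc: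
  assumes "S \<noteq> []"
  shows "gilbreath (S @ [k]) \<longleftrightarrow> gilbreath S \<and> diff_triangle (S @ [k]) (length S) 1 = 1"
proof -
  \<comment> \<open>Nonemptiness matters: for empty \<open>S\<close> the appended row would be row
    0, which carries no condition.\<close>
  have "{1..length (S @ [k]) - 1} = insert (length S) {1..length S - 1}"
    using assms by (cases S) auto
  moreover have "diff_triangle (S @ [k]) b 1 = diff_triangle S b 1"
    if "b \<in> {1..length S - 1}" for b
    using that by (intro diff_triangle_append) auto
  ultimately show ?thesis
    unfolding gilbreath_def by auto
qed

lemma nth_right_antidiagonal:
  assumes "1 \<le> i" and "i < length S"
  shows "right_antidiagonal S ! (i - 1) = diff_triangle S i (length S - i)"
  using assms nth_upt[of 1 "i - 1" "length S"] by (simp add: right_antidiagonal_def)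

text \<open>The row is \<open>Suc i\<close> because row 0 of the new anti-diagonal holds
  \<open>k\<close> itself, and \<open>r 0\<close> is its first difference.\<close>

lemma diff_triangle_snoc_eq_fold_sequence:
  fixes r :: "nat \<Rightarrow> int"
  assumes "r 0 = \<bar>k - S ! (length S - 1)\<bar>"
    and "\<forall>i\<in>{1..length S - 1}. r i = \<bar>r (i - 1) - right_antidiagonal S ! (i - 1)\<bar>"
    and "i < length S"
  shows "diff_triangle (S @ [k]) (Suc i) (length S - i) = r i"
  using assms(3)
proof (induction i)
  case 0
  then show ?case using assms(1) by (simp add: nth_append)
next
  case (Suc i)
  let ?a = "length S - Suc i"
  \<comment> \<open>Of the two entries subtracted, the right one lies on the new anti-diagonal,
    where the induction hypothesis applies; the left one lies on that of \<open>S\<close>.\<close>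
  have "diff_triangle (S @ [k]) (Suc (Suc i)) ?a
      = \<bar>diff_triangle (S @ [k]) (Suc i) (?a + 1) - diff_triangle (S @ [k]) (Suc i) ?a\<bar>"
    by (rule diff_triangle.simps(2))
  also have "?a + 1 = length S - i"
    using Suc.prems by simp
  also have "diff_triangle (S @ [k]) (Suc i) (length S - i) = r i"
    using Suc by simp
  also have "diff_triangle (S @ [k]) (Suc i) ?a = diff_triangle S (Suc i) ?a"
    using Suc.prems by (intro diff_triangle_append) auto
  also have "\<dots> = right_antidiagonal S ! i"
    using nth_right_antidiagonal[of "Suc i" S] Suc.prems by simp
  also have "\<bar>r i - right_antidiagonal S ! i\<bar> = r (Suc i)"
    using assms(2) Suc.prems by simp
  finally show ?case .
qed

text \<open>The conversion by \<open>nat\<close> loses nothing, since absolute values are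
  nonnegative; so the fold obeys the integer recurrence.\<close>

lemma fold_abs_diff_append:
  "int (fold (\<lambda>e x. nat \<bar>int x - e\<bar>) (es @ [e]) d)
    = \<bar>int (fold (\<lambda>e x. nat \<bar>int x - e\<bar>) es d) - e\<bar>"
  by simp

theorem proposition2:
  fixes n :: nat and S :: "int list" and k :: int
  assumes "n \<ge> 2"
    and "S \<in> gilbreath_seqs n"
  shows "(k \<in> valid_extensions S \<longleftrightarrow> folding_map S (nat \<bar>k - S ! (n - 1)\<bar>) = 1) \<and>
    (\<forall>r :: nat \<Rightarrow> int.
       r 0 = \<bar>k - S ! (n - 1)\<bar> \<and>
       (\<forall>i\<in>{1..n - 1}. r i = \<bar>r (i - 1) - right_antidiagonal S ! (i - 1)\<bar>) \<longrightarrow>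
       (k \<in> valid_extensions S \<longleftrightarrow> r (n - 1) = 1))"
proof -
  have len: "length S = n" and gil: "gilbreath S"
    using assms(2) by (auto simp: gilbreath_seqs_def)
  \<comment> \<open>For arbitrary \<open>r\<close> this is the second claim; the first follows by
    choosing a suitable \<open>r\<close>.\<close>
  have iff: "k \<in> valid_extensions S \<longleftrightarrow> r (n - 1) = 1"
    if "r 0 = \<bar>k - S ! (n - 1)\<bar>"
      and "\<forall>i\<in>{1..n - 1}. r i = \<bar>r (i - 1) - right_antidiagonal S ! (i - 1)\<bar>"
    for r :: "nat \<Rightarrow> int"
  proof -
    \<comment> \<open>The case \<open>i = n - 1\<close> is the apex of the extended triangle: row
      \<open>n\<close>, position 1.\<close>
    have "diff_triangle (S @ [k]) (Suc (n - 1)) (n - (n - 1)) = r (n - 1)"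
      using diff_triangle_snoc_eq_fold_sequence[of r k S "n - 1"] that len assms(1) by simp
    moreover have "Suc (n - 1) = n" "n - (n - 1) = 1" "S \<noteq> []"
      using assms(1) len by auto
    ultimately show ?thesis
      using gilbreath_snoc[of S k] gil len by (simp add: valid_extensions_def)
  qed
  define es where "es = right_antidiagonal S"
  define d where "d = nat \<bar>k - S ! (n - 1)\<bar>"
  \<comment> \<open>Folding over prefixes records the intermediate values; as \<open>es\<close> has
    length \<open>n - 1\<close>, \<open>r (n - 1)\<close> is the full fold.\<close>
  define r where "r i = int (fold (\<lambda>e x. nat \<bar>int x - e\<bar>) (take i es) d)" for i
  have len_es: "length es = n - 1"
    by (simp add: es_def right_antidiagonal_def len)
  have "r 0 = \<bar>k - S ! (n - 1)\<bar>"
    by (simp add: r_def d_def)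
  moreover have "r i = \<bar>r (i - 1) - es ! (i - 1)\<bar>" if i: "i \<in> {1..n - 1}" for i
  proof -
    have "take i es = take (i - 1) es @ [es ! (i - 1)]"
      using take_Suc_conv_app_nth[of "i - 1" es] i len_es by auto
    then show ?thesis
      by (simp only: r_def fold_abs_diff_append)
  qed
  ultimately have "k \<in> valid_extensions S \<longleftrightarrow> r (n - 1) = 1"
    using iff[of r] by (simp add: es_def)
  also have "r (n - 1) = int (folding_map S d)"
    by (simp add: r_def folding_map_def len_es flip: es_def)
  finally show ?thesis
    using iff by (simp add: d_def)
qed

end
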